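(* Let $\mathcal{A},\mathcal{B}\in\mathbb{C}^{\mathbf{N}(n)\times\mathbf{N}(n)}$ be such that $\mathcal{A}$, $\mathcal{B}$ and $\mathcal{A}*_n\mathcal{B}$ are core tensors. Then $$\mathscr{R}(\mathcal{A}*_n\mathcal{B}^{\mathrm{core}})\subseteq\mathscr{R}(\mathcal{B}^{\mathrm{core}}*_n\mathcal{A}^{\mathrm{core}})\quad\text{and}\quad \mathcal{B}^**_n\mathcal{A}^{\#}*_n\bigl(\mathcal{I}-(\mathcal{A}*_n\mathcal{B}*_n\mathcal{B}^{\mathrm{core}}*_n\mathcal{A}^{\mathrm{core}})^*\bigr)*_n\mathcal{A}=\mathcal{O}$$ if and only if $(\mathcal{A}*_n\mathcal{B})^{\mathrm{core}}=\mathcal{B}^{\mathrm{core}}*_n\mathcal{A}^{\mathrm{core}}$.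
   Context: Here $\mathbf{N}(n)=N_1\times\cdots\times N_n$ and $\mathbb{C}^{\mathbf{N}(n)\times\mathbf{N}(n)}$ is the set of complex tensors $\mathcal{A}=(a_{i_1\ldots i_n j_1\ldots j_n})$ with $1\le i_k,j_k\le N_k$. The Einstein product is $(\mathcal{A}*_n\mathcal{B})_{i_1\ldots i_n j_1\ldots j_n}=\sum_{k_1,\ldots,k_n}a_{i_1\ldots i_n k_1\ldots k_n}b_{k_1\ldots k_n j_1\ldots j_n}$ (and similarly $\mathcal{A}*_n\mathcal{X}\in\mathbb{C}^{\mathbf{N}(n)}$ for $\mathcal{X}\in\mathbb{C}^{\mathbf{N}(n)}$), powers are taken with respect to $*_n$, $\mathcal{A}^*$ is the conjugate transpose (swap the first $n$ and last $n$ indices and conjugate), $\mathcal{I}$ is the identity tensor for $*_n$ and $\mathcal{O}$ the zero tensor. The range is $\mathscr{R}(\mathcal{A})=\{\mathcal{A}*_n\mathcal{X}:\mathcal{X}\in\mathbb{C}^{\mathbf{N}(n)}\}$. The index $\mathrm{ind}(\mathcal{A})$ is the smallest positive integer $k$ with $\mathscr{R}(\mathcal{A}^k)=\mathscr{R}(\mathcal{A}^{k+1})$; $\mathcal{A}$ is a core tensor if $\mathrm{ind}(\mathcal{A})=1$. The core inverse $\mathcal{A}^{\mathrm{core}}$ is the (unique, existing when $\mathcal{A}$ is a core tensor) tensor $\mathcal{X}$ with $(\mathcal{A}*_n\mathcal{X})^*=\mathcal{A}*_n\mathcal{X}$, $\mathcal{X}*_n\mathcal{A}^2=\mathcal{A}$,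 $\mathcal{A}*_n\mathcal{X}^2=\mathcal{X}$. The group inverse $\mathcal{A}^{\#}$ is the (unique, existing when $\mathrm{ind}(\mathcal{A})=1$) tensor $\mathcal{X}$ with $\mathcal{A}^2*_n\mathcal{X}=\mathcal{A}$, $\mathcal{X}*_n\mathcal{A}*_n\mathcal{X}=\mathcal{X}$, $\mathcal{X}*_n\mathcal{A}=\mathcal{A}*_n\mathcal{X}$. *)

theory Defs
  imports Complex_Main "HOL-Library.FuncSet"
begin

definition multi_indices :: "nat \<Rightarrow> (nat \<Rightarrow> nat) \<Rightarrow> (nat \<Rightarrow> nat) set" where
  "multi_indices n N = (\<Pi>\<^sub>E k\<in>{1..n}. {1..N k})"

text \<open>
  A square tensor \<open>A\<close> has the entry \<open>A i j\<close> at the pair of multi-indices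
  \<open>i = (i\<^sub>1, \<dots>, i\<^sub>n)\<close> and \<open>j = (j\<^sub>1, \<dots>, j\<^sub>n)\<close>.  Entries outside the index set are
  required to be zero, so that equality of tensors is equality of functions.
\<close>

type_synonym half_tensor = "(nat \<Rightarrow> nat) \<Rightarrow> complex"
type_synonym tensor = "(nat \<Rightarrow> nat) \<Rightarrow> (nat \<Rightarrow> nat) \<Rightarrow> complex"

definition half_tensors :: "nat \<Rightarrow> (nat \<Rightarrow> nat) \<Rightarrow> half_tensor set" where
  "half_tensors n N = {X. \<forall>i. i \<notin> multi_indices n N \<longrightarrow> X i = 0}"

definition tensors :: "nat \<Rightarrow> (nat \<Rightarrow> nat) \<Rightarrow> tensor set" where
  "tensors n N =
     {A. \<forall>i j. i \<notin> multi_indices n N \<or> j \<notin> multi_indices n N \<longrightarrow> A i j = 0}"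

definition einstein_prod :: "tensor \<Rightarrow> nat \<Rightarrow> (nat \<Rightarrow> nat) \<Rightarrow> tensor \<Rightarrow> tensor"
    ("(_ \<star>\<^bsub>_,_\<^esub>/ _)" [70, 0, 0, 71] 70) where
  "A \<star>\<^bsub>n,N\<^esub> B = (\<lambda>i j. \<Sum>k\<in>multi_indices n N. A i k * B k j)"

definition einstein_apply :: "nat \<Rightarrow> (nat \<Rightarrow> nat) \<Rightarrow> tensor \<Rightarrow> half_tensor \<Rightarrow> half_tensor" where
  "einstein_apply n N A X = (\<lambda>i. \<Sum>k\<in>multi_indices n N. A i k * X k)"

definition tensor_zero :: tensor where
  "tensor_zero = (\<lambda>i j. 0)"

definition tensor_id :: "nat \<Rightarrow> (nat \<Rightarrow> nat) \<Rightarrow> tensor" where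
  "tensor_id n N = (\<lambda>i j. if i \<in> multi_indices n N \<and> i = j then 1 else 0)"

definition tensor_adjoint :: "tensor \<Rightarrow> tensor" where
  "tensor_adjoint A = (\<lambda>i j. cnj (A j i))"

primrec tensor_power :: "nat \<Rightarrow> (nat \<Rightarrow> nat) \<Rightarrow> tensor \<Rightarrow> nat \<Rightarrow> tensor" where
  "tensor_power n N A 0 = tensor_id n N"
| "tensor_power n N A (Suc k) = A \<star>\<^bsub>n,N\<^esub> tensor_power n N A k"

definition tensor_range :: "nat \<Rightarrow> (nat \<Rightarrow> nat) \<Rightarrow> tensor \<Rightarrow> half_tensor set" where
  "tensor_range n N A = einstein_apply n N A ` half_tensors n N"

definition tensor_index :: "nat \<Rightarrow> (nat \<Rightarrow> nat) \<Rightarrow> tensor \<Rightarrow> nat" where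
  "tensor_index n N A =
     (LEAST k. 0 < k \<and>
        tensor_range n N (tensor_power n N A k) = tensor_range n N (tensor_power n N A (k + 1)))"

definition core_tensor :: "nat \<Rightarrow> (nat \<Rightarrow> nat) \<Rightarrow> tensor \<Rightarrow> bool" where
  "core_tensor n N A \<longleftrightarrow> A \<in> tensors n N \<and> tensor_index n N A = 1"

definition is_core_inverse :: "nat \<Rightarrow> (nat \<Rightarrow> nat) \<Rightarrow> tensor \<Rightarrow> tensor \<Rightarrow> bool" where
  "is_core_inverse n N A X \<longleftrightarrow>
     X \<in> tensors n N \<and>
     tensor_adjoint (A \<star>\<^bsub>n,N\<^esub> X) = A \<star>\<^bsub>n,N\<^esub> X \<and>
     X \<star>\<^bsub>n,N\<^esub> tensor_power n N A 2 = A \<and>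
     A \<star>\<^bsub>n,N\<^esub> tensor_power n N X 2 = X"

text \<open>
  The core inverse and the group inverse are unique if they exist, and both exist for
  core tensors; for other arguments the descriptions below are unspecified.
\<close>

definition core_inverse :: "nat \<Rightarrow> (nat \<Rightarrow> nat) \<Rightarrow> tensor \<Rightarrow> tensor" where
  "core_inverse n N A = (THE X. is_core_inverse n N A X)"

definition is_group_inverse :: "nat \<Rightarrow> (nat \<Rightarrow> nat) \<Rightarrow> tensor \<Rightarrow> tensor \<Rightarrow> bool" where
  "is_group_inverse n N A X \<longleftrightarrow>
     X \<in> tensors n N \<and>
     tensor_power n N A 2 \<star>\<^bsub>n,N\<^esub> X = A \<and>
     X \<star>\<^bsub>n,N\<^esub> A \<star>\<^bsub>n,N\<^esub> X = X \<and>
     X \<star>\<^bsub>n,N\<^esub> A = A \<star>\<^bsub>n,N\<^esub> X"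

definition group_inverse :: "nat \<Rightarrow> (nat \<Rightarrow> nat) \<Rightarrow> tensor \<Rightarrow> tensor" where
  "group_inverse n N A = (THE X. is_group_inverse n N A X)"

end

theory Submission
  imports Defs
begin

text \<open>
  Write \<open>A'\<close> and \<open>X\<close> for the core inverses of \<open>A\<close> and \<open>B\<close>, \<open>G\<close> for the group inverse of
  \<open>A\<close>, and put \<open>C = A B\<close>, \<open>D = X A'\<close>.  The claim is that the two conditions hold if and
  only if \<open>D\<close> is the core inverse of \<open>C\<close>.  Inclusion of ranges is divisibility on the left
  (\<open>range_subset_iff\<close>), so all of this is a statement about a monoid with involution, except
  that finite dimensionality is needed.  It enters in one way only: the powers of a tensor \<open>M\<close>
  are linearly dependent, so that \<open>M\<^sup>r = M\<^sup>r\<^sup>+\<^sup>1 W\<close> for some \<open>r\<close> and some polynomial \<open>W\<close> in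
  \<open>M\<close>.  If \<open>M\<^sup>2\<close> can be cancelled down to \<open>M\<close> on one side, this improves to \<open>M = M\<^sup>2 W\<close>
  (\<open>cancel_left_regular\<close>, \<open>cancel_right_regular\<close>).  Applied to \<open>A\<close> and to \<open>A\<^sup>* A\<close>, it
  yields the existence of group inverses, of orthogonal projectors onto ranges, and hence of core
  inverses, of core tensors.

  Sufficiency (\<open>reverse_order_law_sufficient\<close>).  The equation is equivalent to
  \<open>B\<^sup>* A' = B\<^sup>* A' D\<^sup>* C\<^sup>*\<close>; multiplication by \<open>X X\<^sup>*\<close> gives \<open>D = D D\<^sup>* C\<^sup>*\<close>, that is,
  \<open>D\<^sup>* = C D D\<^sup>*\<close>.  The range inclusion gives \<open>C = D V\<close>.  Let \<open>E\<close> be the orthogonal projector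
  onto the range of \<open>C\<close>.  Then \<open>D E = D\<close>, as the range of \<open>D\<^sup>*\<close> lies in that of \<open>C\<close>, and
  \<open>D\<close> has a right inverse relative to \<open>E\<close>.  In finite dimension this right inverse is two-sided:
  \<open>E = D W = W D\<close> (\<open>right_inverse_two_sided\<close>).  So \<open>E\<close> is a right multiple of \<open>D\<^sup>*\<close>, and
  \<open>D\<^sup>* = C D D\<^sup>*\<close> gives \<open>C D = C D E = E\<close>, from which the equations of the core inverse follow.

  Necessity (\<open>reverse_order_law_necessary\<close>).  Since \<open>A X = C X\<^sup>2\<close> and \<open>C = D C\<^sup>2\<close>, the range
  inclusion is immediate.  Let \<open>P = A A'\<close> and \<open>Q = B X\<close> be the orthogonal projectors onto the
  ranges of \<open>A\<close> and \<open>B\<close>.  The range of \<open>D\<close> lies in that of \<open>C\<close>, hence in that of \<open>A\<close>, so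
  that \<open>X\<close> leaves the range of \<open>A\<close> invariant.  Now \<open>Q\<close> is a polynomial in \<open>X\<close>, so it does the
  same (\<open>invariant_projector\<close>) and, being Hermitian, commutes with \<open>P\<close>.  With this, the
  hermiticity of \<open>C D\<close> turns into the required equation.
\<close>

section \<open>Linear dependence of functions on a finite set\<close>

text \<open>More functions on a finite set than the set has points are linearly dependent on it.\<close>

lemma linear_dependence_on_finite_set:
  fixes v :: "nat \<Rightarrow> 'b \<Rightarrow> 'a :: field"
  assumes "finite S"
  shows "\<exists>c. (\<exists>i\<le>card S. c i \<noteq> 0) \<and> (\<forall>x\<in>S. (\<Sum>i\<le>card S. c i * v i x) = 0)"
  using assms
proof (induction S arbitrary: v rule: finite_induct)
  case empty
  show ?case by (intro exI[of _ "\<lambda>_. 1"]) auto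
next
  case (insert y S)
  let ?m = "card S"
  show ?case
  proof (cases "\<exists>p\<le>Suc ?m. v p y \<noteq> 0")
    case False
    obtain c where c: "\<exists>i\<le>?m. c i \<noteq> 0" "\<forall>x\<in>S. (\<Sum>i\<le>?m. c i * v i x) = 0"
      using insert.IH by blast
    define d where "d = (\<lambda>i. if i \<le> ?m then c i else 0)"
    have "(\<Sum>i\<le>Suc ?m. d i * v i x) = (\<Sum>i\<le>?m. c i * v i x)" for x
      by (simp add: d_def)
    moreover have "(\<Sum>i\<le>?m. c i * v i y) = 0"
      using False by (intro sum.neutral) auto
    moreover have "\<exists>i\<le>Suc ?m. d i \<noteq> 0"
      using c(1) by (auto simp: d_def intro: le_SucI)
    ultimately show ?thesis
      using c(2) insert.hyps by (intro exI[of _ d]) auto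
  next
    case True
    then obtain p where p: "p \<le> Suc ?m" "v p y \<noteq> 0" by blast
    \<comment> \<open>Subtract multiples of the pivot \<open>v p\<close> from the other functions, which \<open>s\<close> enumerates,
       so that they vanish at \<open>y\<close>.\<close>
    define s where "s = (\<lambda>i. if i < p then i else Suc i)"
    define q where "q = (\<lambda>i. v (s i) y / v p y)"
    obtain c where c: "\<exists>i\<le>?m. c i \<noteq> 0"
        "\<forall>x\<in>S. (\<Sum>i\<le>?m. c i * (v (s i) x - q i * v p x)) = 0"
      using insert.IH[of "\<lambda>i x. v (s i) x - q i * v p x"] by blast
    have inj: "inj_on s {..?m}" by (auto simp: inj_on_def s_def split: if_splits)
    have img: "{..Suc ?m} = insert p (s ` {..?m})"
    proof (rule card_subset_eq[symmetric])
      show "insert p (s ` {..?m}) \<subseteq> {..Suc ?m}" using p by (auto simp: s_def)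
      have "p \<notin> s ` {..?m}" by (auto simp: s_def split: if_splits)
      then show "card (insert p (s ` {..?m})) = card {..Suc ?m}"
        by (simp add: card_image[OF inj])
    qed simp
    have pnot: "p \<notin> s ` {..?m}" by (auto simp: s_def split: if_splits)
    define d where "d = (\<lambda>i. if i = p then - (\<Sum>k\<le>?m. c k * q k) else c (the_inv_into {..?m} s i))"
    have ds: "d (s i) = c i" if "i \<le> ?m" for i
      using that pnot inj by (auto simp: d_def the_inv_into_f_f)
    have sum_eq: "(\<Sum>i\<le>Suc ?m. d i * v i x) = (\<Sum>i\<le>?m. c i * (v (s i) x - q i * v p x))" for x
    proof -
      have "(\<Sum>i\<le>Suc ?m. d i * v i x) = d p * v p x + (\<Sum>i\<le>?m. d (s i) * v (s i) x)"
        unfolding img using pnot by (simp add: sum.reindex[OF inj] del: sum.atMost_Suc)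
      also have "(\<Sum>i\<le>?m. d (s i) * v (s i) x) = (\<Sum>i\<le>?m. c i * v (s i) x)"
        by (intro sum.cong) (auto simp: ds)
      finally show ?thesis
        by (simp add: d_def right_diff_distrib sum_subtractf sum_distrib_right mult.assoc)
    qed
    have "(\<Sum>i\<le>?m. c i * (v (s i) y - q i * v p y)) = 0"
      using p by (intro sum.neutral) (auto simp: q_def)
    moreover have "\<exists>i\<le>Suc ?m. d i \<noteq> 0"
    proof -
      obtain i where i: "i \<le> ?m" "c i \<noteq> 0" using c(1) by blast
      then have "s i \<le> Suc ?m" by (auto simp: s_def)
      with i ds[of i] show ?thesis by auto
    qed
    ultimately show ?thesis
      using c(2) insert.hyps sum_eq by (intro exI[of _ d]) (auto simp del: sum.atMost_Suc)
  qed
qed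

section \<open>The algebra of tensors under the Einstein product\<close>

lemma finite_multi_indices: "finite (multi_indices n N)"
  unfolding multi_indices_def by (intro finite_PiE) auto

text \<open>
  The locale fixes the shape of the tensors, so that the product can be written without it.
  Associativity and the laws of the involution hold for arbitrary functions; only the identity
  laws and the properness of the involution need the entries outside the index set to vanish.
\<close>

locale tensor_space =
  fixes n :: nat and N :: "nat \<Rightarrow> nat"
begin

abbreviation prod_nN :: "tensor \<Rightarrow> tensor \<Rightarrow> tensor" (infixl "\<cdot>" 70)
  where "A \<cdot> B \<equiv> A \<star>\<^bsub>n,N\<^esub> B"

abbreviation carrier_nN :: "tensor set" ("\<T>") where "\<T> \<equiv> tensors n N"
abbreviation id_nN :: tensor ("\<I>") where "\<I> \<equiv> tensor_id n N"
abbreviation pow_nN :: "tensor \<Rightarrow> nat \<Rightarrow> tensor" where "pow_nN \<equiv> tensor_power n N"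

notation tensor_adjoint ("_\<^sup>\<dagger>" [1000] 1000)

lemma einstein_assoc: "A \<cdot> B \<cdot> C = A \<cdot> (B \<cdot> C)"
proof (intro ext)
  fix i j
  have "(A \<cdot> B \<cdot> C) i j = (\<Sum>k\<in>multi_indices n N. \<Sum>l\<in>multi_indices n N. A i l * B l k * C k j)"
    by (simp add: einstein_prod_def sum_distrib_right)
  also have "\<dots> = (\<Sum>l\<in>multi_indices n N. \<Sum>k\<in>multi_indices n N. A i l * B l k * C k j)"
    by (rule sum.swap)
  also have "\<dots> = (A \<cdot> (B \<cdot> C)) i j"
    by (simp add: einstein_prod_def sum_distrib_left mult.assoc)
  finally show "(A \<cdot> B \<cdot> C) i j = (A \<cdot> (B \<cdot> C)) i j" .
qed

lemma einstein_apply_prod: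
  "einstein_apply n N (A \<cdot> B) v = einstein_apply n N A (einstein_apply n N B v)"
proof (rule ext)
  fix i
  have "einstein_apply n N (A \<cdot> B) v i
      = (\<Sum>k\<in>multi_indices n N. \<Sum>l\<in>multi_indices n N. A i l * B l k * v k)"
    by (simp add: einstein_prod_def einstein_apply_def sum_distrib_right)
  also have "\<dots> = (\<Sum>l\<in>multi_indices n N. \<Sum>k\<in>multi_indices n N. A i l * B l k * v k)"
    by (rule sum.swap)
  also have "\<dots> = einstein_apply n N A (einstein_apply n N B v) i"
    by (simp add: einstein_apply_def sum_distrib_left mult.assoc)
  finally show "einstein_apply n N (A \<cdot> B) v i = \<dots>" .
qed

lemma einstein_closed [simp]: "A \<in> \<T> \<Longrightarrow> B \<in> \<T> \<Longrightarrow> A \<cdot> B \<in> \<T>"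
  by (auto simp: tensors_def einstein_prod_def)

lemma id_closed [simp]: "\<I> \<in> \<T>"
  by (auto simp: tensors_def tensor_id_def)

lemma adjoint_closed [simp]: "A \<in> \<T> \<Longrightarrow> A\<^sup>\<dagger> \<in> \<T>"
  by (auto simp: tensors_def tensor_adjoint_def)

lemma einstein_id_left [simp]: "A \<in> \<T> \<Longrightarrow> \<I> \<cdot> A = A"
proof (intro ext)
  fix i j assume A: "A \<in> \<T>"
  have "(\<I> \<cdot> A) i j = (\<Sum>k\<in>multi_indices n N. if i = k then A k j else 0)"
    unfolding einstein_prod_def tensor_id_def by (intro sum.cong) auto
  also have "\<dots> = A i j"
    using A by (auto simp: finite_multi_indices tensors_def)
  finally show "(\<I> \<cdot> A) i j = A i j" .
qed

lemma einstein_id_right [simp]: "A \<in> \<T> \<Longrightarrow> A \<cdot> \<I> = A"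
proof (intro ext)
  fix i j assume A: "A \<in> \<T>"
  have "(A \<cdot> \<I>) i j = (\<Sum>k\<in>multi_indices n N. if k = j then A i k else 0)"
    unfolding einstein_prod_def tensor_id_def by (intro sum.cong) auto
  also have "\<dots> = A i j"
    using A by (auto simp: finite_multi_indices tensors_def)
  finally show "(A \<cdot> \<I>) i j = A i j" .
qed

lemma adjoint_prod: "(A \<cdot> B)\<^sup>\<dagger> = B\<^sup>\<dagger> \<cdot> A\<^sup>\<dagger>"
  by (simp add: tensor_adjoint_def einstein_prod_def mult.commute)

lemma adjoint_adjoint [simp]: "A\<^sup>\<dagger>\<^sup>\<dagger> = A"
  by (simp add: tensor_adjoint_def)

lemma einstein_diff_left: "(A - B) \<cdot> C = A \<cdot> C - B \<cdot> C"
  by (simp add: einstein_prod_def fun_eq_iff left_diff_distrib sum_subtractf)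

lemma einstein_diff_right: "A \<cdot> (B - C) = A \<cdot> B - A \<cdot> C"
  by (simp add: einstein_prod_def fun_eq_iff right_diff_distrib sum_subtractf)

lemma tensor_diff_eq_zero_iff: "A - B = tensor_zero \<longleftrightarrow> A = B"
  by (simp add: tensor_zero_def fun_eq_iff)

lemma adjoint_prod_eq_zero:
  assumes "A \<in> \<T>" and "A\<^sup>\<dagger> \<cdot> A = tensor_zero"
  shows "A = tensor_zero"
proof -
  have "A k j = 0" for k j
  proof (cases "k \<in> multi_indices n N")
    case True
    have "(A\<^sup>\<dagger> \<cdot> A) j j = (\<Sum>k\<in>multi_indices n N. of_real ((cmod (A k j))\<^sup>2))"
      by (simp only: einstein_prod_def tensor_adjoint_def complex_norm_square) (simp add: mult.commute)
    then have "complex_of_real (\<Sum>k\<in>multi_indices n N. (cmod (A k j))\<^sup>2) = 0"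
      using assms(2) by (simp add: tensor_zero_def)
    then have "(\<Sum>k\<in>multi_indices n N. (cmod (A k j))\<^sup>2) = 0"
      by (simp only: of_real_eq_0_iff)
    then show ?thesis
      using True by (simp add: sum_nonneg_eq_0_iff finite_multi_indices)
  qed (use assms(1) in \<open>auto simp: tensors_def\<close>)
  then show ?thesis by (simp add: tensor_zero_def fun_eq_iff)
qed

text \<open>The involution is proper: \<open>A\<^sup>\<dagger> \<cdot> A\<close> can be cancelled down to \<open>A\<close>.\<close>

lemma adjoint_cancel:
  assumes "A \<in> \<T>" "U \<in> \<T>" "V \<in> \<T>" and eq: "A\<^sup>\<dagger> \<cdot> (A \<cdot> U) = A\<^sup>\<dagger> \<cdot> (A \<cdot> V)"
  shows "A \<cdot> U = A \<cdot> V"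
proof -
  let ?Z = "A \<cdot> (U - V)"
  have "U - V \<in> \<T>" using assms by (auto simp: tensors_def)
  have "A\<^sup>\<dagger> \<cdot> ?Z = tensor_zero"
    using eq by (simp add: einstein_diff_right tensor_diff_eq_zero_iff)
  then have "?Z\<^sup>\<dagger> \<cdot> ?Z = (U - V)\<^sup>\<dagger> \<cdot> tensor_zero"
    by (simp only: adjoint_prod einstein_assoc)
  then have "?Z\<^sup>\<dagger> \<cdot> ?Z = tensor_zero"
    by (simp add: einstein_prod_def tensor_zero_def)
  moreover have "?Z \<in> \<T>" using \<open>U - V \<in> \<T>\<close> assms(1) by simp
  ultimately have "?Z = tensor_zero" by (rule adjoint_prod_eq_zero[rotated])
  then show ?thesis by (simp add: einstein_diff_right tensor_diff_eq_zero_iff)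
qed

lemma power_closed [simp]: "M \<in> \<T> \<Longrightarrow> pow_nN M k \<in> \<T>"
  by (induction k) auto

lemma power_two: "M \<in> \<T> \<Longrightarrow> pow_nN M 2 = M \<cdot> M"
  by (simp add: numeral_2_eq_2)

lemma power_add: "M \<in> \<T> \<Longrightarrow> pow_nN M (k + l) = pow_nN M k \<cdot> pow_nN M l"
  by (induction k) (auto simp: einstein_assoc)

lemma power_Suc_right: "M \<in> \<T> \<Longrightarrow> pow_nN M (Suc k) = pow_nN M k \<cdot> M"
  using power_add[of M k 1] by simp

text \<open>Inclusion of ranges is divisibility on the left.\<close>

lemma range_subset_iff:
  assumes "U \<in> \<T>" "V \<in> \<T>"
  shows "tensor_range n N U \<subseteq> tensor_range n N V \<longleftrightarrow> (\<exists>Z\<in>\<T>. U = V \<cdot> Z)"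
proof
  assume sub: "tensor_range n N U \<subseteq> tensor_range n N V"
  have "\<exists>z\<in>half_tensors n N. (\<lambda>i. U i j) = einstein_apply n N V z" if "j \<in> multi_indices n N" for j
  proof -
    let ?u = "\<lambda>k. if k = j then 1 else 0 :: complex"
    have "?u \<in> half_tensors n N" using that by (auto simp: half_tensors_def)
    moreover have "einstein_apply n N U ?u = (\<lambda>i. U i j)"
    proof (rule ext)
      fix i
      have "einstein_apply n N U ?u i = (\<Sum>k\<in>multi_indices n N. if k = j then U i k else 0)"
        unfolding einstein_apply_def by (intro sum.cong) auto
      then show "einstein_apply n N U ?u i = U i j"
        using that by (simp add: finite_multi_indices)
    qed
    ultimately have "(\<lambda>i. U i j) \<in> tensor_range n N U"
      unfolding tensor_range_def by (metis imageI)
    then show ?thesis using sub by (auto simp: tensor_range_def)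
  qed
  then obtain z where z: "\<And>j. j \<in> multi_indices n N \<Longrightarrow>
      z j \<in> half_tensors n N \<and> (\<lambda>i. U i j) = einstein_apply n N V (z j)"
    by metis
  define Z where "Z = (\<lambda>i j. if j \<in> multi_indices n N then z j i else 0)"
  have "Z \<in> \<T>" using z by (auto simp: Z_def tensors_def half_tensors_def)
  moreover have "U i j = (V \<cdot> Z) i j" for i j
  proof (cases "j \<in> multi_indices n N")
    case True
    then show ?thesis
      using z[OF True] by (auto simp: einstein_prod_def Z_def einstein_apply_def dest: fun_cong)
  qed (use assms in \<open>auto simp: tensors_def einstein_prod_def Z_def\<close>)
  ultimately show "\<exists>Z\<in>\<T>. U = V \<cdot> Z" by blast
next
  assume "\<exists>Z\<in>\<T>. U = V \<cdot> Z"
  then obtain Z where Z: "Z \<in> \<T>" "U = V \<cdot> Z" by blast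
  have "einstein_apply n N Z x \<in> half_tensors n N" for x
    using Z by (auto simp: half_tensors_def tensors_def einstein_apply_def)
  then show "tensor_range n N U \<subseteq> tensor_range n N V"
    by (auto simp: tensor_range_def Z einstein_apply_prod)
qed

section \<open>Powers of a tensor and cancellation\<close>

text \<open>The linear combination \<open>\<Sum>k\<in>I. c k f k\<close> of tensors.\<close>

definition lincomb :: "(nat \<Rightarrow> complex) \<Rightarrow> (nat \<Rightarrow> tensor) \<Rightarrow> nat set \<Rightarrow> tensor" where
  "lincomb c f I = (\<lambda>i j. \<Sum>k\<in>I. c k * f k i j)"

lemma lincomb_closed [simp]: "(\<And>k. k \<in> I \<Longrightarrow> f k \<in> \<T>) \<Longrightarrow> lincomb c f I \<in> \<T>"
  by (auto simp: lincomb_def tensors_def intro!: sum.neutral)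

lemma lincomb_cong:
  "(\<And>k. k \<in> I \<Longrightarrow> f k = g k) \<Longrightarrow> lincomb c f I = lincomb c g I"
  by (simp add: lincomb_def)

lemma prod_lincomb: "A \<cdot> lincomb c f I = lincomb c (\<lambda>k. A \<cdot> f k) I"
proof (intro ext)
  fix i j
  have "(A \<cdot> lincomb c f I) i j = (\<Sum>l\<in>multi_indices n N. \<Sum>k\<in>I. c k * (A i l * f k l j))"
    by (simp add: einstein_prod_def lincomb_def sum_distrib_left mult.left_commute)
  also have "\<dots> = (\<Sum>k\<in>I. \<Sum>l\<in>multi_indices n N. c k * (A i l * f k l j))"
    by (rule sum.swap)
  also have "\<dots> = lincomb c (\<lambda>k. A \<cdot> f k) I i j"
    by (simp add: einstein_prod_def lincomb_def sum_distrib_left)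
  finally show "(A \<cdot> lincomb c f I) i j = \<dots>" .
qed

lemma lincomb_prod: "lincomb c f I \<cdot> A = lincomb c (\<lambda>k. f k \<cdot> A) I"
proof (intro ext)
  fix i j
  have "(lincomb c f I \<cdot> A) i j = (\<Sum>l\<in>multi_indices n N. \<Sum>k\<in>I. c k * (f k i l * A l j))"
    by (simp add: einstein_prod_def lincomb_def sum_distrib_right mult.assoc)
  also have "\<dots> = (\<Sum>k\<in>I. \<Sum>l\<in>multi_indices n N. c k * (f k i l * A l j))"
    by (rule sum.swap)
  also have "\<dots> = lincomb c (\<lambda>k. f k \<cdot> A) I i j"
    by (simp add: einstein_prod_def lincomb_def sum_distrib_left)
  finally show "(lincomb c f I \<cdot> A) i j = \<dots>" .
qed

text \<open>
  \<open>W\<close> behaves like a polynomial in \<open>M\<close>: it commutes with \<open>M\<close>, and it leaves invariant the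
  range of every idempotent \<open>P\<close> whose range \<open>M\<close> leaves invariant.  The coefficients of an actual
  polynomial play no role.
\<close>

definition poly_like :: "tensor \<Rightarrow> tensor \<Rightarrow> bool" where
  "poly_like M W \<longleftrightarrow> W \<in> \<T> \<and> W \<cdot> M = M \<cdot> W \<and>
     (\<forall>P\<in>\<T>. P \<cdot> P = P \<longrightarrow> M \<cdot> P = P \<cdot> M \<cdot> P \<longrightarrow> W \<cdot> P = P \<cdot> W \<cdot> P)"

lemma power_invariant:
  assumes "M \<in> \<T>" "P \<in> \<T>" "P \<cdot> P = P" "M \<cdot> P = P \<cdot> M \<cdot> P"
  shows "pow_nN M k \<cdot> P = P \<cdot> (pow_nN M k \<cdot> P)"
proof (induction k)
  case (Suc k)
  have "pow_nN M (Suc k) \<cdot> P = M \<cdot> (P \<cdot> (pow_nN M k \<cdot> P))"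
    using Suc by (simp add: einstein_assoc)
  also have "\<dots> = P \<cdot> (M \<cdot> (P \<cdot> (pow_nN M k \<cdot> P)))"
    using assms(4) by (metis einstein_assoc)
  also have "\<dots> = P \<cdot> (pow_nN M (Suc k) \<cdot> P)"
    using Suc by (simp add: einstein_assoc)
  finally show ?case .
qed (use assms in auto)

lemma poly_like_lincomb:
  assumes "M \<in> \<T>"
  shows "poly_like M (lincomb c (\<lambda>k. pow_nN M (f k)) I)"
  unfolding poly_like_def
proof (intro conjI ballI impI)
  show "lincomb c (\<lambda>k. pow_nN M (f k)) I \<in> \<T>" using assms by simp
  show "lincomb c (\<lambda>k. pow_nN M (f k)) I \<cdot> M = M \<cdot> lincomb c (\<lambda>k. pow_nN M (f k)) I"
    using power_Suc_right[OF assms] by (simp add: prod_lincomb lincomb_prod)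
  fix P assume "P \<in> \<T>" "P \<cdot> P = P" "M \<cdot> P = P \<cdot> M \<cdot> P"
  then show "lincomb c (\<lambda>k. pow_nN M (f k)) I \<cdot> P = P \<cdot> lincomb c (\<lambda>k. pow_nN M (f k)) I \<cdot> P"
    using power_invariant[OF assms, of P]
    by (simp add: prod_lincomb lincomb_prod einstein_assoc)
qed

text \<open>
  The powers of \<open>M\<close> are linearly dependent; divide a dependence relation by the coefficient
  of its lowest power.
\<close>

lemma power_eq_power_Suc_prod:
  assumes M: "M \<in> \<T>"
  shows "\<exists>r W. poly_like M W \<and> pow_nN M r = pow_nN M (Suc r) \<cdot> W"
proof -
  let ?S = "multi_indices n N \<times> multi_indices n N"
  let ?m = "card ?S"
  obtain c where c: "\<exists>i\<le>?m. c i \<noteq> 0"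
      "\<forall>x\<in>?S. (\<Sum>i\<le>?m. c i * (case x of (a, b) \<Rightarrow> pow_nN M i a b)) = 0"
    using linear_dependence_on_finite_set[of ?S "\<lambda>i x. case x of (a, b) \<Rightarrow> pow_nN M i a b"]
      finite_multi_indices by blast
  have zero: "(\<Sum>i\<le>?m. c i * pow_nN M i a b) = 0" for a b
  proof (cases "(a, b) \<in> ?S")
    case False
    then have "pow_nN M i a b = 0" for i
      using power_closed[OF M, of i] by (auto simp: tensors_def)
    then show ?thesis by simp
  qed (use c(2) in force)
  define r where "r = (LEAST i. c i \<noteq> 0)"
  have r: "c r \<noteq> 0" "r \<le> ?m" "\<And>i. i < r \<Longrightarrow> c i = 0"
  proof -
    obtain i where i: "i \<le> ?m" "c i \<noteq> 0" using c(1) by blast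
    show "c r \<noteq> 0" unfolding r_def using i(2) by (rule LeastI)
    show "r \<le> ?m" using i Least_le[of "\<lambda>i. c i \<noteq> 0" i] unfolding r_def by linarith
    show "c i = 0" if "i < r" for i using not_less_Least that unfolding r_def by blast
  qed
  define W where "W = lincomb (\<lambda>i. - c i / c r) (\<lambda>i. pow_nN M (i - Suc r)) {r<..?m}"
  have "pow_nN M (Suc r) \<cdot> W = lincomb (\<lambda>i. - c i / c r) (\<lambda>i. pow_nN M i) {r<..?m}"
    unfolding W_def prod_lincomb
    by (rule lincomb_cong) (simp add: M power_add[symmetric] del: tensor_power.simps)
  also have "\<dots> = pow_nN M r"
  proof (intro ext)
    fix a b
    have "{..?m} = {..<r} \<union> ({r} \<union> {r<..?m})" using r(2) by auto
    then have "0 = (\<Sum>i\<in>{..<r} \<union> ({r} \<union> {r<..?m}). c i * pow_nN M i a b)"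
      using zero[of a b] by simp
    also have "\<dots> = (\<Sum>i<r. c i * pow_nN M i a b)
        + (c r * pow_nN M r a b + (\<Sum>i\<in>{r<..?m}. c i * pow_nN M i a b))"
      by (subst sum.union_disjoint; (subst sum.union_disjoint)?) auto
    also have "(\<Sum>i<r. c i * pow_nN M i a b) = 0" using r(3) by simp
    finally have "(\<Sum>i\<in>{r<..?m}. c i * pow_nN M i a b) = - (c r * pow_nN M r a b)"
      by (simp add: eq_neg_iff_add_eq_0 add.commute)
    moreover have "lincomb (\<lambda>i. - c i / c r) (\<lambda>i. pow_nN M i) {r<..?m} a b
        = - (\<Sum>i\<in>{r<..?m}. c i * pow_nN M i a b) / c r"
      by (simp add: lincomb_def sum_negf sum_divide_distrib)
    ultimately show "lincomb (\<lambda>i. - c i / c r) (\<lambda>i. pow_nN M i) {r<..?m} a b = pow_nN M r a b"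
      using r(1) by simp
  qed
  finally show ?thesis using poly_like_lincomb[OF M] W_def by metis
qed

text \<open>
  If the second power of \<open>M\<close> can be cancelled down to the first, on either side, then
  so can all powers, and \<open>M\<^sup>r = M\<^sup>r\<^sup>+\<^sup>1 W\<close> becomes \<open>M = M\<^sup>2 W\<close>.
\<close>

lemma cancel_left_regular:
  assumes M: "M \<in> \<T>"
    and cancel: "\<And>U V. U \<in> \<T> \<Longrightarrow> V \<in> \<T> \<Longrightarrow> M \<cdot> (M \<cdot> U) = M \<cdot> (M \<cdot> V) \<Longrightarrow> M \<cdot> U = M \<cdot> V"
  shows "\<exists>W. poly_like M W \<and> M \<cdot> (M \<cdot> W) = M"
proof -
  obtain r W where W: "poly_like M W" "pow_nN M r = pow_nN M (Suc r) \<cdot> W"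
    using power_eq_power_Suc_prod[OF M] by blast
  have "W \<in> \<T>" using W by (auto simp: poly_like_def)
  have "M \<cdot> U = M \<cdot> V"
    if "U \<in> \<T>" "V \<in> \<T>" "M \<cdot> (pow_nN M k \<cdot> U) = M \<cdot> (pow_nN M k \<cdot> V)" for k U V
    using that
  proof (induction k)
    case (Suc k)
    then have "M \<cdot> (M \<cdot> (pow_nN M k \<cdot> U)) = M \<cdot> (M \<cdot> (pow_nN M k \<cdot> V))"
      by (simp add: einstein_assoc)
    then show ?case
      using Suc.IH Suc.prems(1,2) cancel M by (meson einstein_closed power_closed)
  qed simp
  moreover have "M \<cdot> (pow_nN M r \<cdot> \<I>) = M \<cdot> (pow_nN M r \<cdot> (M \<cdot> W))"
    using W(2) power_Suc_right[OF M, of r] M by (metis einstein_assoc einstein_id_right power_closed)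
  ultimately show ?thesis using W(1) M by (metis einstein_closed einstein_id_right id_closed \<open>W \<in> \<T>\<close>)
qed

lemma cancel_right_regular:
  assumes M: "M \<in> \<T>"
    and cancel: "\<And>U V. U \<in> \<T> \<Longrightarrow> V \<in> \<T> \<Longrightarrow> U \<cdot> M \<cdot> M = V \<cdot> M \<cdot> M \<Longrightarrow> U \<cdot> M = V \<cdot> M"
  shows "\<exists>W. poly_like M W \<and> M \<cdot> (M \<cdot> W) = M"
proof -
  obtain r W where W: "poly_like M W" "pow_nN M r = pow_nN M (Suc r) \<cdot> W"
    using power_eq_power_Suc_prod[OF M] by blast
  have [simp]: "W \<in> \<T>" and comm: "W \<cdot> M = M \<cdot> W" using W by (auto simp: poly_like_def)
  have step: "U \<cdot> M = V \<cdot> M"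
    if "U \<in> \<T>" "V \<in> \<T>" "U \<cdot> pow_nN M k \<cdot> M = V \<cdot> pow_nN M k \<cdot> M" for k U V
    using that
  proof (induction k)
    case (Suc k)
    then have "U \<cdot> pow_nN M k \<cdot> M \<cdot> M = V \<cdot> pow_nN M k \<cdot> M \<cdot> M"
      using power_Suc_right[OF M, of k] by (simp add: einstein_assoc del: tensor_power.simps)
    then show ?case
      using Suc.IH Suc.prems(1,2) cancel M by (meson einstein_closed power_closed)
  qed (use M in simp)
  have powcomm: "pow_nN M k \<cdot> W = W \<cdot> pow_nN M k" for k
  proof (induction k)
    case (Suc k)
    then show ?case by (simp add: einstein_assoc) (metis einstein_assoc comm)
  qed simp
  have "\<I> \<cdot> pow_nN M r \<cdot> M = (W \<cdot> M) \<cdot> pow_nN M r \<cdot> M"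
  proof -
    have "pow_nN M r = W \<cdot> pow_nN M (Suc r)" using W(2) powcomm[of "Suc r"] by simp
    then show ?thesis using M by (simp add: einstein_assoc)
  qed
  then have "M = W \<cdot> M \<cdot> M" using step[of \<I> "W \<cdot> M" r] M by simp
  also have "\<dots> = M \<cdot> (M \<cdot> W)" using comm by (metis einstein_assoc)
  finally show ?thesis using W(1) by metis
qed

section \<open>Core inverses and group inverses\<close>

lemma is_core_inverse_iff:
  assumes "A \<in> \<T>"
  shows "is_core_inverse n N A X \<longleftrightarrow>
    X \<in> \<T> \<and> (A \<cdot> X)\<^sup>\<dagger> = A \<cdot> X \<and> X \<cdot> (A \<cdot> A) = A \<and> A \<cdot> (X \<cdot> X) = X"
  using assms by (auto simp: is_core_inverse_def power_two)

lemma is_group_inverse_iff: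
  assumes "A \<in> \<T>"
  shows "is_group_inverse n N A X \<longleftrightarrow>
    X \<in> \<T> \<and> A \<cdot> (A \<cdot> X) = A \<and> X \<cdot> (A \<cdot> X) = X \<and> X \<cdot> A = A \<cdot> X"
  using assms by (auto simp: is_group_inverse_def power_two einstein_assoc)

text \<open>A core inverse is an inner and outer inverse.\<close>

lemma core_inverse_regular:
  assumes "X \<cdot> (A \<cdot> A) = A" "A \<cdot> (X \<cdot> X) = X"
  shows "A \<cdot> (X \<cdot> A) = A" "X \<cdot> (A \<cdot> X) = X"
  using assms by (metis einstein_assoc)+

lemma core_inverse_unique:
  assumes A: "A \<in> \<T>" and "is_core_inverse n N A X" and "is_core_inverse n N A Y"
  shows "X = Y"
proof -
  have X: "(A \<cdot> X)\<^sup>\<dagger> = A \<cdot> X" "X \<cdot> (A \<cdot> A) = A" "A \<cdot> (X \<cdot> X) = X"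
   and Y: "(A \<cdot> Y)\<^sup>\<dagger> = A \<cdot> Y" "Y \<cdot> (A \<cdot> A) = A" "A \<cdot> (Y \<cdot> Y) = Y"
    using assms(2,3) by (auto simp: is_core_inverse_iff[OF A])
  note Xr = core_inverse_regular[OF X(2,3)] and Yr = core_inverse_regular[OF Y(2,3)]
  have "A \<cdot> X = (A \<cdot> Y) \<cdot> (A \<cdot> X)" using Yr(1) by (metis einstein_assoc)
  then have "A \<cdot> X = (A \<cdot> X) \<cdot> (A \<cdot> Y)" using X(1) Y(1) adjoint_prod by metis
  also have "\<dots> = A \<cdot> Y" using Xr(1) by (metis einstein_assoc)
  finally have proj: "A \<cdot> X = A \<cdot> Y" .
  have "X = Y \<cdot> (A \<cdot> X)" using X(3) Y(2) by (metis einstein_assoc)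
  then show ?thesis using proj Yr(2) by simp
qed

lemma group_inverse_unique:
  assumes A: "A \<in> \<T>" and "is_group_inverse n N A X" and "is_group_inverse n N A Y"
  shows "X = Y"
proof -
  have X: "A \<cdot> (A \<cdot> X) = A" "X \<cdot> (A \<cdot> X) = X" "X \<cdot> A = A \<cdot> X"
   and Y: "A \<cdot> (A \<cdot> Y) = A" "Y \<cdot> (A \<cdot> Y) = Y" "Y \<cdot> A = A \<cdot> Y"
    using assms(2,3) by (auto simp: is_group_inverse_iff[OF A])
  have "A \<cdot> X = X \<cdot> (A \<cdot> (A \<cdot> Y))" using X(3) Y(1) by simp
  also have "\<dots> = A \<cdot> (A \<cdot> X) \<cdot> Y" using X(3) by (metis einstein_assoc)
  finally have eq: "A \<cdot> X = A \<cdot> Y" using X(1) by simp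
  have "X = (Y \<cdot> A) \<cdot> X" using X(2,3) Y(3) eq by (metis einstein_assoc)
  then show ?thesis using eq Y(2) by (simp add: einstein_assoc)
qed

text \<open>
  The index is the least element of a set that might be empty, so its value 1 says something
  only because the ranges of the powers do become stationary.
\<close>

lemma core_tensor_divides_square:
  assumes "core_tensor n N A"
  shows "\<exists>Z\<in>\<T>. A \<cdot> (A \<cdot> Z) = A"
proof -
  have A: "A \<in> \<T>" using assms by (simp add: core_tensor_def)
  let ?stable = "\<lambda>k. 0 < k \<and> tensor_range n N (pow_nN A k) = tensor_range n N (pow_nN A (k + 1))"
  have desc: "tensor_range n N (pow_nN A (Suc k)) \<subseteq> tensor_range n N (pow_nN A k)" for k
    using power_Suc_right[OF A, of k] A
    by (subst range_subset_iff) (auto simp del: tensor_power.simps)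
  obtain r W where W: "poly_like A W" "pow_nN A r = pow_nN A (Suc r) \<cdot> W"
    using power_eq_power_Suc_prod[OF A] by blast
  have "pow_nN A (Suc r) = pow_nN A (Suc (Suc r)) \<cdot> W"
    using W(2) by (metis einstein_assoc tensor_power.simps(2))
  then have "tensor_range n N (pow_nN A (Suc r)) \<subseteq> tensor_range n N (pow_nN A (Suc (Suc r)))"
    using W(1) A by (subst range_subset_iff) (auto simp: poly_like_def simp del: tensor_power.simps)
  then have "?stable (Suc r)" using desc[of "Suc r"] by auto
  then have "?stable (tensor_index n N A)" unfolding tensor_index_def by (rule LeastI)
  then have "tensor_range n N A \<subseteq> tensor_range n N (A \<cdot> A)"
    using assms A by (auto simp: core_tensor_def)
  then obtain Z where "Z \<in> \<T>" "A = A \<cdot> A \<cdot> Z" using A by (auto simp: range_subset_iff)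
  then show ?thesis using einstein_assoc by metis
qed

text \<open>
  Orthogonal projection onto a range.  The tensor \<open>H = A\<^sup>\<dagger> \<cdot> A\<close> is a multiple of its
  square, \<open>H = H \<cdot> H \<cdot> W\<close>, because the involution is proper.  Cancelling \<open>A\<^sup>\<dagger>\<close> gives
  \<open>A = A \<cdot> W \<cdot> A\<^sup>\<dagger> \<cdot> A\<close>, and \<open>A \<cdot> W \<cdot> A\<^sup>\<dagger>\<close> is the projector.
\<close>

lemma orthogonal_projector_exists:
  assumes A: "A \<in> \<T>"
  shows "\<exists>E U. E \<in> \<T> \<and> U \<in> \<T> \<and> E = A \<cdot> U \<and> E\<^sup>\<dagger> = E \<and> E \<cdot> A = A"
proof -
  let ?H = "A\<^sup>\<dagger> \<cdot> A"
  have H: "?H \<in> \<T>" using A by simp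
  have cancel: "?H \<cdot> U = ?H \<cdot> V" if "U \<in> \<T>" "V \<in> \<T>" "?H \<cdot> (?H \<cdot> U) = ?H \<cdot> (?H \<cdot> V)" for U V
  proof (rule adjoint_cancel[OF H that(1,2)])
    show "?H\<^sup>\<dagger> \<cdot> (?H \<cdot> U) = ?H\<^sup>\<dagger> \<cdot> (?H \<cdot> V)"
      unfolding adjoint_prod adjoint_adjoint by (rule that(3))
  qed
  obtain W where W: "poly_like ?H W" "?H \<cdot> (?H \<cdot> W) = ?H"
    using cancel_left_regular[OF H cancel] by blast
  have [simp]: "W \<in> \<T>" and comm: "W \<cdot> ?H = ?H \<cdot> W" using W by (auto simp: poly_like_def)
  have "A\<^sup>\<dagger> \<cdot> (A \<cdot> \<I>) = A\<^sup>\<dagger> \<cdot> (A \<cdot> (?H \<cdot> W))"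
    using W(2) A by (simp add: einstein_assoc)
  then have "A \<cdot> (?H \<cdot> W) = A" using adjoint_cancel[of A \<I> "?H \<cdot> W"] A by simp
  then have EA: "A \<cdot> (W \<cdot> A\<^sup>\<dagger>) \<cdot> A = A" using comm by (simp add: einstein_assoc)
  define E where "E = A \<cdot> (W \<cdot> A\<^sup>\<dagger>)"
  have "A\<^sup>\<dagger> \<cdot> E\<^sup>\<dagger> = A\<^sup>\<dagger>" using EA adjoint_prod unfolding E_def by metis
  \<comment> \<open>Hermitian, since \<open>E \<cdot> E\<^sup>\<dagger>\<close> is.\<close>
  then have "E = E \<cdot> E\<^sup>\<dagger>" by (simp add: E_def einstein_assoc)
  then have "E\<^sup>\<dagger> = E" by (metis adjoint_prod adjoint_adjoint)
  moreover have "E \<in> \<T>" "W \<cdot> A\<^sup>\<dagger> \<in> \<T>" using A by (auto simp: E_def)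
  ultimately show ?thesis using EA E_def by metis
qed

lemma group_inverse_exists:
  assumes "core_tensor n N A"
  shows "\<exists>X. is_group_inverse n N A X"
proof -
  have A: "A \<in> \<T>" using assms by (simp add: core_tensor_def)
  obtain Z where Z: "Z \<in> \<T>" "A \<cdot> (A \<cdot> Z) = A"
    using core_tensor_divides_square[OF assms] by blast
  have "U \<cdot> A = V \<cdot> A" if "U \<cdot> A \<cdot> A = V \<cdot> A \<cdot> A" for U V
    using that Z(2) by (metis einstein_assoc)
  then obtain W where W: "poly_like A W" "A \<cdot> (A \<cdot> W) = A"
    using cancel_right_regular[OF A] by blast
  have [simp]: "W \<in> \<T>" and comm: "W \<cdot> A = A \<cdot> W" using W by (auto simp: poly_like_def)
  \<comment> \<open>\<open>W\<close> itself need not satisfy \<open>W \<cdot> A \<cdot> W = W\<close>.\<close>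
  define X where "X = A \<cdot> (W \<cdot> W)"
  have "A \<cdot> X = A \<cdot> W" using W(2) unfolding X_def by (metis einstein_assoc)
  moreover have "X \<cdot> A = A \<cdot> W"
    using W(2) comm unfolding X_def by (metis einstein_assoc)
  ultimately show ?thesis
    using A W(2) comm unfolding is_group_inverse_iff[OF A]
    by (intro exI[of _ X]) (auto simp: X_def, (metis einstein_assoc)+)
qed

lemma is_group_inverse_group_inverse:
  "core_tensor n N A \<Longrightarrow> is_group_inverse n N A (group_inverse n N A)"
  unfolding group_inverse_def
  using group_inverse_exists group_inverse_unique core_tensor_def by (metis theI)

text \<open>The core inverse is \<open>A\<^sup># \<cdot> E\<close> for the orthogonal projector \<open>E\<close> onto the range of \<open>A\<close>.\<close>

lemma core_inverse_exists:
  assumes "core_tensor n N A"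
  shows "\<exists>X. is_core_inverse n N A X"
proof -
  have A: "A \<in> \<T>" using assms by (simp add: core_tensor_def)
  obtain G where G: "G \<in> \<T>" "A \<cdot> (A \<cdot> G) = A" "G \<cdot> (A \<cdot> G) = G" "G \<cdot> A = A \<cdot> G"
    using group_inverse_exists[OF assms] by (auto simp: is_group_inverse_iff[OF A])
  obtain E U where E: "E \<in> \<T>" "E = A \<cdot> U" "E\<^sup>\<dagger> = E" "E \<cdot> A = A"
    using orthogonal_projector_exists[OF A] by blast
  have AX: "A \<cdot> (G \<cdot> E) = E" using G E(2) by (metis einstein_assoc)
  moreover have "G \<cdot> E \<cdot> (A \<cdot> A) = A" using G E(4) by (metis einstein_assoc)
  moreover have "A \<cdot> (G \<cdot> E \<cdot> (G \<cdot> E)) = G \<cdot> E"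
    using AX G E(4) by (metis einstein_assoc)
  ultimately show ?thesis
    using G(1) E(1,3) by (intro exI[of _ "G \<cdot> E"]) (auto simp: is_core_inverse_iff[OF A])
qed

lemma is_core_inverse_core_inverse:
  "core_tensor n N A \<Longrightarrow> is_core_inverse n N A (core_inverse n N A)"
  unfolding core_inverse_def
  using core_inverse_exists core_inverse_unique core_tensor_def by (metis theI)

section \<open>The reverse order law\<close>

text \<open>
  A right inverse \<open>G\<close> of \<open>D\<close> relative to \<open>E\<close>, where \<open>D = D \<cdot> E\<close>, can be replaced by a
  two-sided one.  Here \<open>G\<close> allows \<open>D \<cdot> D\<close> to be cancelled on the right down to \<open>D\<close>.
\<close>

lemma right_inverse_two_sided:
  assumes "D \<in> \<T>" "G \<in> \<T>" "E \<in> \<T>" "D \<cdot> E = D" "D \<cdot> G = E"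
  shows "\<exists>W\<in>\<T>. E = W \<cdot> D \<and> E = D \<cdot> W"
proof -
  have "U \<cdot> D = V \<cdot> D" if "U \<cdot> D \<cdot> D = V \<cdot> D \<cdot> D" for U V
    using that assms(4,5) by (metis einstein_assoc)
  then obtain W where W: "poly_like D W" "D \<cdot> (D \<cdot> W) = D"
    using cancel_right_regular[OF assms(1)] by blast
  have [simp]: "W \<in> \<T>" and comm: "W \<cdot> D = D \<cdot> W" using W by (auto simp: poly_like_def)
  have "E = W \<cdot> (D \<cdot> (D \<cdot> G))" using assms(5) W(2) comm by (metis einstein_assoc)
  then have "E = W \<cdot> D" using assms(4,5) by simp
  then show ?thesis using comm \<open>W \<in> \<T>\<close> by metis
qed

text \<open>
  If \<open>B \<cdot> X \<cdot> X = X\<close>, then \<open>B \<cdot> X\<close> equals \<open>X \<cdot> W\<close> with \<open>W\<close> a polynomial in \<open>X\<close>, and so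
  leaves invariant what \<open>X\<close> leaves invariant.
\<close>

lemma invariant_projector:
  assumes "X \<in> \<T>" "P \<in> \<T>" "P \<cdot> P = P" "X \<cdot> P = P \<cdot> X \<cdot> P" "B \<cdot> (X \<cdot> X) = X"
  shows "B \<cdot> X \<cdot> P = P \<cdot> (B \<cdot> X) \<cdot> P"
proof -
  have "X \<cdot> U = X \<cdot> V" if "X \<cdot> (X \<cdot> U) = X \<cdot> (X \<cdot> V)" for U V
    using that assms(5) by (metis einstein_assoc)
  then obtain W where W: "poly_like X W" "X \<cdot> (X \<cdot> W) = X"
    using cancel_left_regular[OF assms(1)] by blast
  have Q: "B \<cdot> X = X \<cdot> W" using W(2) assms(5) by (metis einstein_assoc)
  have "W \<cdot> P = P \<cdot> W \<cdot> P" using W(1) assms(2-4) by (auto simp: poly_like_def)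
  then show ?thesis unfolding Q using assms(3,4) by (metis einstein_assoc)
qed

lemma reverse_order_law_sufficient:
  assumes cA: "core_tensor n N A" and cB: "core_tensor n N B" and cC: "core_tensor n N (A \<cdot> B)"
    and iA: "is_core_inverse n N A A'" and iB: "is_core_inverse n N B X"
    and iG: "is_group_inverse n N A G"
    and rng: "V \<in> \<T>" "A \<cdot> X = X \<cdot> A' \<cdot> V"
    and eq: "B\<^sup>\<dagger> \<cdot> G \<cdot> A = B\<^sup>\<dagger> \<cdot> G \<cdot> (A \<cdot> B \<cdot> X \<cdot> A')\<^sup>\<dagger> \<cdot> A"
  shows "is_core_inverse n N (A \<cdot> B) (X \<cdot> A')"
proof -
  have A: "A \<in> \<T>" and B: "B \<in> \<T>" using cA cB by (auto simp: core_tensor_def)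
  have A': "A' \<in> \<T>" "(A \<cdot> A')\<^sup>\<dagger> = A \<cdot> A'" "A' \<cdot> (A \<cdot> A) = A" "A \<cdot> (A' \<cdot> A') = A'"
    using iA by (auto simp: is_core_inverse_iff[OF A])
  have X: "X \<in> \<T>" "(B \<cdot> X)\<^sup>\<dagger> = B \<cdot> X" "X \<cdot> (B \<cdot> B) = B" "B \<cdot> (X \<cdot> X) = X"
    using iB by (auto simp: is_core_inverse_iff[OF B])
  have G: "A \<cdot> (A \<cdot> G) = A" "G \<cdot> (A \<cdot> G) = G" "G \<cdot> A = A \<cdot> G"
    using iG by (auto simp: is_group_inverse_iff[OF A])
  note A'r = core_inverse_regular[OF A'(3,4)] and Xr = core_inverse_regular[OF X(3,4)]
  define C where "C = A \<cdot> B"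
  define D where "D = X \<cdot> A'"
  have D: "D \<in> \<T>" and C: "C \<in> \<T>" using A B A' X by (auto simp: C_def D_def)
  \<comment> \<open>Multiplied by \<open>A'\<close> on the right, the equation no longer involves \<open>G\<close>, because
     \<open>G\<close> and \<open>A'\<close> agree on the range of \<open>A\<close>, which contains that of \<open>D\<^sup>\<dagger>\<close>.\<close>
  have GA': "G \<cdot> (A \<cdot> A') = A'"
    using G A'(4) by (metis einstein_assoc)
  have PC: "A \<cdot> A' \<cdot> C = C" using A'r(1) unfolding C_def by (metis einstein_assoc)
  have "A'\<^sup>\<dagger> = (A \<cdot> A') \<cdot> A'\<^sup>\<dagger>" using A'r(2) A'(2) adjoint_prod by metis
  then have GD: "G \<cdot> D\<^sup>\<dagger> = A' \<cdot> D\<^sup>\<dagger>"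
    using GA' unfolding D_def adjoint_prod by (metis einstein_assoc)
  have "C\<^sup>\<dagger> \<cdot> (A \<cdot> A') = C\<^sup>\<dagger>" using PC A'(2) by (metis adjoint_prod)
  moreover have "B\<^sup>\<dagger> \<cdot> G \<cdot> A = B\<^sup>\<dagger> \<cdot> G \<cdot> (C \<cdot> D)\<^sup>\<dagger> \<cdot> A"
    using eq by (simp add: C_def D_def einstein_assoc)
  then have "B\<^sup>\<dagger> \<cdot> (G \<cdot> (A \<cdot> A')) = B\<^sup>\<dagger> \<cdot> ((G \<cdot> D\<^sup>\<dagger>) \<cdot> (C\<^sup>\<dagger> \<cdot> (A \<cdot> A')))"
    by (metis adjoint_prod einstein_assoc)
  ultimately have key: "B\<^sup>\<dagger> \<cdot> A' = B\<^sup>\<dagger> \<cdot> (A' \<cdot> (D\<^sup>\<dagger> \<cdot> C\<^sup>\<dagger>))"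
    by (simp add: GA' GD einstein_assoc)
  have "D = X \<cdot> ((B \<cdot> X)\<^sup>\<dagger> \<cdot> A')"
    unfolding X(2) D_def using Xr(2) by (metis einstein_assoc)
  then have DX: "D = X \<cdot> (X\<^sup>\<dagger> \<cdot> (B\<^sup>\<dagger> \<cdot> A'))" by (simp add: adjoint_prod einstein_assoc)
  then have "D = D \<cdot> (D\<^sup>\<dagger> \<cdot> C\<^sup>\<dagger>)" using key by (metis einstein_assoc)
  then have Dstar: "D\<^sup>\<dagger> = C \<cdot> (D \<cdot> D\<^sup>\<dagger>)"
    by (metis adjoint_prod adjoint_adjoint einstein_assoc)
  \<comment> \<open>The range inclusion makes \<open>D\<close> divide \<open>C\<close>, because \<open>C = A \<cdot> X \<cdot> B\<^sup>2\<close>.\<close>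
  have "C = A \<cdot> X \<cdot> (B \<cdot> B)" unfolding C_def using X(3) by (metis einstein_assoc)
  then have CV: "C = D \<cdot> (V \<cdot> (B \<cdot> B))" using rng(2) by (simp add: D_def einstein_assoc)
  obtain C' where C': "C' \<in> \<T>" "(C \<cdot> C')\<^sup>\<dagger> = C \<cdot> C'" "C' \<cdot> (C \<cdot> C) = C" "C \<cdot> (C' \<cdot> C') = C'"
    using core_inverse_exists[OF cC[folded C_def]] by (auto simp: is_core_inverse_iff[OF C])
  \<comment> \<open>The orthogonal projector onto the range of \<open>C\<close>, which contains the range of \<open>D\<^sup>\<dagger>\<close>.\<close>
  define E where "E = C \<cdot> C'"
  have EC: "E \<cdot> C = C"
    using core_inverse_regular[OF C'(3,4)] by (simp add: E_def einstein_assoc)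
  have Eh: "E\<^sup>\<dagger> = E" using C' E_def by simp
  have "E \<cdot> D\<^sup>\<dagger> = D\<^sup>\<dagger>" using Dstar EC by (metis einstein_assoc)
  then have DE: "D \<cdot> E = D" using Eh by (metis adjoint_prod adjoint_adjoint)
  have "D \<cdot> (V \<cdot> (B \<cdot> B) \<cdot> C') = E" unfolding E_def using CV by (metis einstein_assoc)
  then obtain W where W: "W \<in> \<T>" "E = W \<cdot> D" "E = D \<cdot> W"
    using right_inverse_two_sided[of D "V \<cdot> (B \<cdot> B) \<cdot> C'" E] D DE C C' rng B E_def by auto
  have ED: "E \<cdot> D = D" using W DE by (metis einstein_assoc)
  have "E = D\<^sup>\<dagger> \<cdot> W\<^sup>\<dagger>" using W(2) Eh adjoint_prod by metis
  then have "C \<cdot> (D \<cdot> E) = E" using Dstar by (metis einstein_assoc)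
  then have CD: "C \<cdot> D = E" using DE by simp
  have "C \<cdot> E = E \<cdot> W" using CD W(3) by (metis einstein_assoc)
  then have "D \<cdot> (C \<cdot> E) = E" using DE W(3) by (metis einstein_assoc)
  then have "D \<cdot> (C \<cdot> C) = C" using EC by (metis einstein_assoc)
  moreover have "C \<cdot> (D \<cdot> D) = D" using CD ED by (metis einstein_assoc)
  ultimately show ?thesis
    using CD Eh D is_core_inverse_iff[OF C] by (simp add: C_def D_def)
qed

lemma reverse_order_law_necessary:
  assumes cA: "core_tensor n N A" and cB: "core_tensor n N B"
    and iA: "is_core_inverse n N A A'" and iB: "is_core_inverse n N B X"
    and iG: "is_group_inverse n N A G"
    and iC: "is_core_inverse n N (A \<cdot> B) (X \<cdot> A')"
  shows "\<exists>V\<in>\<T>. A \<cdot> X = X \<cdot> A' \<cdot> V"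
    and "B\<^sup>\<dagger> \<cdot> G \<cdot> A = B\<^sup>\<dagger> \<cdot> G \<cdot> (A \<cdot> B \<cdot> X \<cdot> A')\<^sup>\<dagger> \<cdot> A"
proof -
  have A: "A \<in> \<T>" and B: "B \<in> \<T>" using cA cB by (auto simp: core_tensor_def)
  have A': "A' \<in> \<T>" "(A \<cdot> A')\<^sup>\<dagger> = A \<cdot> A'" "A' \<cdot> (A \<cdot> A) = A" "A \<cdot> (A' \<cdot> A') = A'"
    using iA by (auto simp: is_core_inverse_iff[OF A])
  have X: "X \<in> \<T>" "(B \<cdot> X)\<^sup>\<dagger> = B \<cdot> X" "X \<cdot> (B \<cdot> B) = B" "B \<cdot> (X \<cdot> X) = X"
    using iB by (auto simp: is_core_inverse_iff[OF B])
  have G: "A \<cdot> (A \<cdot> G) = A" "G \<cdot> (A \<cdot> G) = G" "G \<cdot> A = A \<cdot> G"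
    using iG by (auto simp: is_group_inverse_iff[OF A])
  note A'r = core_inverse_regular[OF A'(3,4)] and Xr = core_inverse_regular[OF X(3,4)]
  define C where "C = A \<cdot> B"
  define D where "D = X \<cdot> A'"
  have DT: "D \<in> \<T>" and C: "C \<in> \<T>" using A B A' X by (auto simp: C_def D_def)
  have D: "(C \<cdot> D)\<^sup>\<dagger> = C \<cdot> D" "D \<cdot> (C \<cdot> C) = C" "C \<cdot> (D \<cdot> D) = D"
    using iC is_core_inverse_iff[OF C] by (auto simp: C_def D_def)
  have "A \<cdot> X = C \<cdot> (X \<cdot> X)" unfolding C_def using X(4) by (metis einstein_assoc)
  then have "A \<cdot> X = D \<cdot> (C \<cdot> C \<cdot> (X \<cdot> X))" using D(2) by (metis einstein_assoc)
  then show "\<exists>V\<in>\<T>. A \<cdot> X = X \<cdot> A' \<cdot> V"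
    using C X(1) unfolding D_def by (intro bexI[of _ "C \<cdot> C \<cdot> (X \<cdot> X)"]) auto
  define P where "P = A \<cdot> A'"
  define Q where "Q = B \<cdot> X"
  have P: "P \<in> \<T>" "P\<^sup>\<dagger> = P" "P \<cdot> A = A" using A A' A'r by (auto simp: P_def einstein_assoc)
  have PP: "P \<cdot> P = P" using P(3) unfolding P_def by (metis einstein_assoc)
  have "P \<cdot> C = C" unfolding C_def using P(3) by (metis einstein_assoc)
  then have PD: "P \<cdot> D = D" using D(3) by (metis einstein_assoc)
  \<comment> \<open>\<open>X\<close> maps the range of \<open>A\<close> into the range of \<open>D\<close>, which lies in the range of \<open>A\<close>.\<close>
  have "X \<cdot> P = D \<cdot> (A \<cdot> P)"
  proof -
    have "A' \<cdot> (A \<cdot> P) = P" using A'(3) unfolding P_def by (metis einstein_assoc)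
    then show ?thesis by (simp add: D_def einstein_assoc)
  qed
  then have "X \<cdot> P = P \<cdot> X \<cdot> P" using PD by (metis einstein_assoc)
  then have "Q \<cdot> P = P \<cdot> Q \<cdot> P"
    unfolding Q_def using invariant_projector X P PP by blast
  then have QP: "Q \<cdot> P = P \<cdot> Q"
    using P(2) X(2) unfolding Q_def[symmetric] by (metis adjoint_prod einstein_assoc)
  have CD: "C \<cdot> D = A \<cdot> (Q \<cdot> A')" by (simp add: C_def D_def Q_def einstein_assoc)
  have QB: "Q \<cdot> B = B" using Xr by (simp add: Q_def einstein_assoc)
  have A'P: "A'\<^sup>\<dagger> \<cdot> P = A'\<^sup>\<dagger>"
  proof -
    have "P \<cdot> A' = A'" using A'(4) P(3) by (metis einstein_assoc)
    then show ?thesis using P(2) by (metis adjoint_prod)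
  qed
  have "A' \<cdot> (A \<cdot> P) = P" using A'(3) unfolding P_def by (metis einstein_assoc)
  then have PA'A: "P \<cdot> (A\<^sup>\<dagger> \<cdot> A'\<^sup>\<dagger>) = P"
    using P(2) by (metis adjoint_prod einstein_assoc)
  \<comment> \<open>Compute with the adjoint \<open>A'\<^sup>\<dagger> \<cdot> Q \<cdot> A\<^sup>\<dagger>\<close> of \<open>C \<cdot> D\<close>: the commuting of \<open>P\<close> and \<open>Q\<close>
     brings together the factors of \<open>P \<cdot> A\<^sup>\<dagger> \<cdot> A'\<^sup>\<dagger> = P\<close>.\<close>
  have "(C \<cdot> D) \<cdot> (A'\<^sup>\<dagger> \<cdot> B) = (A \<cdot> (Q \<cdot> A'))\<^sup>\<dagger> \<cdot> (A'\<^sup>\<dagger> \<cdot> B)"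
    using D(1) CD by simp
  also have "\<dots> = A'\<^sup>\<dagger> \<cdot> (Q \<cdot> (A\<^sup>\<dagger> \<cdot> (A'\<^sup>\<dagger> \<cdot> B)))"
    using X(2) by (simp add: adjoint_prod Q_def[symmetric] einstein_assoc)
  also have "\<dots> = A'\<^sup>\<dagger> \<cdot> (Q \<cdot> (P \<cdot> (A\<^sup>\<dagger> \<cdot> A'\<^sup>\<dagger>) \<cdot> B))"
    using A'P QP by (metis einstein_assoc)
  also have "\<dots> = A'\<^sup>\<dagger> \<cdot> B"
    unfolding PA'A using QP QB A'P by (metis einstein_assoc)
  finally have "B\<^sup>\<dagger> \<cdot> A' = B\<^sup>\<dagger> \<cdot> (A' \<cdot> (C \<cdot> D))"
    using D(1) by (metis adjoint_prod adjoint_adjoint einstein_assoc)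
  moreover have GP: "G \<cdot> P = A'"
    unfolding P_def using G A'(4) by (metis einstein_assoc)
  moreover have "P \<cdot> (C \<cdot> D) = C \<cdot> D" using \<open>P \<cdot> C = C\<close> by (metis einstein_assoc)
  ultimately have "B\<^sup>\<dagger> \<cdot> G \<cdot> P = B\<^sup>\<dagger> \<cdot> G \<cdot> (C \<cdot> D)" by (metis einstein_assoc)
  then have "B\<^sup>\<dagger> \<cdot> G \<cdot> A = B\<^sup>\<dagger> \<cdot> G \<cdot> (C \<cdot> D) \<cdot> A" using P(3) by (metis einstein_assoc)
  then show "B\<^sup>\<dagger> \<cdot> G \<cdot> A = B\<^sup>\<dagger> \<cdot> G \<cdot> (A \<cdot> B \<cdot> X \<cdot> A')\<^sup>\<dagger> \<cdot> A"
    using D(1) by (simp add: C_def D_def einstein_assoc)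
qed

end

theorem theorem3p6:
  fixes n :: nat and N :: "nat \<Rightarrow> nat" and A B :: tensor
  assumes "n \<ge> 1" and "\<And>k. k \<in> {1..n} \<Longrightarrow> N k \<ge> 1"
    and "A \<in> tensors n N" and "B \<in> tensors n N"
    and "core_tensor n N A" and "core_tensor n N B" and "core_tensor n N (A \<star>\<^bsub>n,N\<^esub> B)"
  shows "tensor_range n N (A \<star>\<^bsub>n,N\<^esub> core_inverse n N B)
           \<subseteq> tensor_range n N (core_inverse n N B \<star>\<^bsub>n,N\<^esub> core_inverse n N A) \<and>
         tensor_adjoint B \<star>\<^bsub>n,N\<^esub> group_inverse n N A
           \<star>\<^bsub>n,N\<^esub> (tensor_id n N
                - tensor_adjoint
                    (A \<star>\<^bsub>n,N\<^esub> B \<star>\<^bsub>n,N\<^esub> core_inverse n N B \<star>\<^bsub>n,N\<^esub> core_inverse n N A))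
           \<star>\<^bsub>n,N\<^esub> A = tensor_zero
     \<longleftrightarrow> core_inverse n N (A \<star>\<^bsub>n,N\<^esub> B) = core_inverse n N B \<star>\<^bsub>n,N\<^esub> core_inverse n N A"
proof -
  interpret tensor_space n N .
  let ?A' = "core_inverse n N A" and ?X = "core_inverse n N B" and ?G = "group_inverse n N A"
  have A': "is_core_inverse n N A ?A'" and X: "is_core_inverse n N B ?X"
    and G: "is_group_inverse n N A ?G"
    and C: "is_core_inverse n N (A \<cdot> B) (core_inverse n N (A \<cdot> B))"
    using assms is_core_inverse_core_inverse is_group_inverse_group_inverse by blast+
  have T: "?A' \<in> \<T>" "?X \<in> \<T>" "?G \<in> \<T>" "A \<in> \<T>" "B \<in> \<T>"
    using A' X G assms by (auto simp: is_core_inverse_def is_group_inverse_def)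
  have range_iff: "tensor_range n N (A \<cdot> ?X) \<subseteq> tensor_range n N (?X \<cdot> ?A')
      \<longleftrightarrow> (\<exists>V\<in>\<T>. A \<cdot> ?X = ?X \<cdot> ?A' \<cdot> V)"
    using T by (intro range_subset_iff) auto
  have eq_iff: "B\<^sup>\<dagger> \<cdot> ?G \<cdot> (\<I> - (A \<cdot> B \<cdot> ?X \<cdot> ?A')\<^sup>\<dagger>) \<cdot> A = tensor_zero
      \<longleftrightarrow> B\<^sup>\<dagger> \<cdot> ?G \<cdot> A = B\<^sup>\<dagger> \<cdot> ?G \<cdot> (A \<cdot> B \<cdot> ?X \<cdot> ?A')\<^sup>\<dagger> \<cdot> A"
    using T by (simp add: einstein_diff_left einstein_diff_right tensor_diff_eq_zero_iff)
  have core_iff: "core_inverse n N (A \<cdot> B) = ?X \<cdot> ?A' \<longleftrightarrow> is_core_inverse n N (A \<cdot> B) (?X \<cdot> ?A')"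
    using C T core_inverse_unique[of "A \<cdot> B"] by (metis einstein_closed)
  show ?thesis
    unfolding range_iff eq_iff core_iff
    using reverse_order_law_sufficient[OF assms(5-7) A' X G]
      reverse_order_law_necessary[OF assms(5,6) A' X G] by blast
qed

end
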